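(* Let $k\ge 1$ be an integer. If $T$ is a tree and if $\mathcal{T}$ is a $k$-Helly collection of leaf-cuttable subtrees of $T$, then there exists a set $E$ of at most $k-1$ edges of $T$ such that every $T_i\in\mathcal{T}$ contains at least one edge of $E$.
   Context: Graphs are finite and simple. Given a tree $T$, a subgraph $T'\subseteq T$ is a subtree of $T$ if $T'$ is itself a tree. A leaf of a tree is a vertex of degree $1$ in it. A subtree $T'$ of $T$ is leaf-cuttable if it has at least one edge and if every edge in $E(T)\setminus E(T')$ which is incident to a vertex of $T'$ is incident to a leaf of $T'$. A collection $\mathcal{T}$ of subtrees of $T$ is $k$-Helly if for any $T_1,\ldots,T_k\in\mathcal{T}$ there exist some $i\ne j$ with $E(T_i)\cap E(T_j)\ne\emptyset$; by convention, $\mathcal{T}$ is $1$-Helly if and only if $\mathcal{T}=\emptyset$. *)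

theory Defs
  imports Main
begin

text \<open>
  Finite simple graphs are given by a vertex set and a set of two-element vertex sets. The notion
  \<open>tree\<close> of the AFP entry Graph Theory is not used: it forbids directed cycles, so a
  symmetric digraph containing an edge \<open>uv\<close> (hence the cycle \<open>u, v, u\<close>) is not a tree there.
\<close>

record 'a graph =
  verts :: "'a set"
  edges :: "'a set set"

definition simple_graph :: "'a graph \<Rightarrow> bool" where
  "simple_graph G \<longleftrightarrow>
     finite (verts G) \<and> (\<forall>e\<in>edges G. e \<subseteq> verts G \<and> card e = 2)"

definition walk :: "'a graph \<Rightarrow> 'a list \<Rightarrow> bool" where
  "walk G p \<longleftrightarrow>
     p \<noteq> [] \<and> set p \<subseteq> verts G \<and> successively (\<lambda>u v. {u, v} \<in> edges G) p"

definition connected_graph :: "'a graph \<Rightarrow> bool" where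
  "connected_graph G \<longleftrightarrow>
     verts G \<noteq> {} \<and> (\<forall>u\<in>verts G. \<forall>v\<in>verts G. \<exists>p. walk G p \<and> hd p = u \<and> last p = v)"

text \<open>A cycle is listed without repeating its first vertex at the end.\<close>

definition cycle :: "'a graph \<Rightarrow> 'a list \<Rightarrow> bool" where
  "cycle G p \<longleftrightarrow> walk G p \<and> length p \<ge> 3 \<and> distinct p \<and> {last p, hd p} \<in> edges G"

definition tree :: "'a graph \<Rightarrow> bool" where
  "tree G \<longleftrightarrow> simple_graph G \<and> connected_graph G \<and> \<not> (\<exists>p. cycle G p)"

definition subgraph :: "'a graph \<Rightarrow> 'a graph \<Rightarrow> bool" where
  "subgraph H G \<longleftrightarrow> simple_graph H \<and> verts H \<subseteq> verts G \<and> edges H \<subseteq> edges G"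

definition subtree :: "'a graph \<Rightarrow> 'a graph \<Rightarrow> bool" where
  "subtree T' T \<longleftrightarrow> subgraph T' T \<and> tree T'"

definition degree :: "'a graph \<Rightarrow> 'a \<Rightarrow> nat" where
  "degree G v = card {e \<in> edges G. v \<in> e}"

definition leaf :: "'a graph \<Rightarrow> 'a \<Rightarrow> bool" where
  "leaf T v \<longleftrightarrow> v \<in> verts T \<and> degree T v = 1"

definition leaf_cuttable :: "'a graph \<Rightarrow> 'a graph \<Rightarrow> bool" where
  "leaf_cuttable T' T \<longleftrightarrow>
     edges T' \<noteq> {} \<and>
     (\<forall>e \<in> edges T - edges T'. (\<exists>v\<in>verts T'. v \<in> e) \<longrightarrow> (\<exists>v. leaf T' v \<and> v \<in> e))"

text \<open>
  The chosen members need not be distinct. For subtrees with at least one edge this makes no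
  difference, as a repeated member shares an edge with itself.
\<close>

definition k_helly :: "nat \<Rightarrow> 'a graph set \<Rightarrow> bool" where
  "k_helly k \<T> \<longleftrightarrow>
     (\<forall>S :: nat \<Rightarrow> 'a graph. (\<forall>i\<in>{1..k}. S i \<in> \<T>) \<longrightarrow>
        (\<exists>i\<in>{1..k}. \<exists>j\<in>{1..k}. i \<noteq> j \<and> edges (S i) \<inter> edges (S j) \<noteq> {}))"

text \<open>The convention for \<open>k = 1\<close> is an instance of the general definition.\<close>

lemma k_helly_1: "k_helly 1 \<T> \<longleftrightarrow> \<T> = {}"
  unfolding k_helly_def by auto

end

theory Submission
  imports Defs
begin

text \<open>
  Root \<open>T\<close> at a leaf. By leaf-cuttability, the vertex of a member of \<open>\<T>\<close> closest to the root is a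
  leaf of that member, so every member has a unique topmost edge. If the topmost edge \<open>e\<close> of a
  member \<open>X\<close> is as deep as possible, then every member sharing an edge with \<open>X\<close> climbs from that edge
  at least up to \<open>e\<close>, hence contains \<open>e\<close>. So put \<open>e\<close> into \<open>E\<close>; the members avoiding \<open>e\<close> share no edge
  with \<open>X\<close>, so they form a \<open>(k - 1)\<close>-Helly collection.
\<close>

section \<open>Adjacency as a relation, and paths without repeated vertices\<close>

abbreviation adj :: "'a graph \<Rightarrow> 'a \<Rightarrow> 'a \<Rightarrow> bool" where
  "adj G u v \<equiv> {u, v} \<in> edges G"

lemma walk_imp_rtranclp:
  assumes "walk G p"
  shows "(adj G)\<^sup>*\<^sup>* (hd p) (last p)"
proof -
  have "successively (adj G) p \<Longrightarrow> p \<noteq> [] \<Longrightarrow> (adj G)\<^sup>*\<^sup>* (hd p) (last p)"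
  proof (induction p)
    case (Cons x p)
    then show ?case
      by (cases p) (auto intro: converse_rtranclp_into_rtranclp)
  qed simp
  then show ?thesis
    using assms by (simp add: walk_def)
qed

lemma connected_graph_rtranclp:
  assumes "connected_graph G" "u \<in> verts G" "v \<in> verts G"
  shows "(adj G)\<^sup>*\<^sup>* u v"
  using assms walk_imp_rtranclp unfolding connected_graph_def by metis

text \<open>The last clause records that every vertex other than \<open>u\<close> is the target of
  an \<open>R\<close> step, so that restrictions built into \<open>R\<close> carry over to the
  vertices of the path.\<close>

lemma rtranclp_distinct_path:
  assumes "R\<^sup>*\<^sup>* u v"
  obtains p where "p \<noteq> []" "hd p = u" "last p = v" "distinct p" "successively R p"
    "\<forall>w\<in>set p. w = u \<or> (\<exists>x. R x w)"
proof -
  have "\<exists>p. p \<noteq> [] \<and> hd p = u \<and> last p = v \<and> distinct p \<and> successively R p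
      \<and> (\<forall>w\<in>set p. w = u \<or> (\<exists>x. R x w))"
    using assms
  proof (induction rule: rtranclp_induct)
    case base
    show ?case by (intro exI[of _ "[u]"]) simp
  next
    case (step y z)
    then obtain p where p: "p \<noteq> []" "hd p = u" "last p = y" "distinct p" "successively R p"
      "\<forall>w\<in>set p. w = u \<or> (\<exists>x. R x w)" by blast
    show ?case
    proof (cases "z \<in> set p")
      case True
      \<comment> \<open>The walk returns to \<open>z\<close>, so the path is cut right after its
        earlier visit to \<open>z\<close>.\<close>
      then obtain as bs where "p = as @ z # bs" by (meson split_list)
      then have "p = (as @ [z]) @ bs" by simp
      then show ?thesis
        using p by (intro exI[of _ "as @ [z]"])
          (auto simp: successively_append_iff hd_append split: if_splits)
    next
      case False
      then show ?thesis
        using p step.hyps by (intro exI[of _ "p @ [z]"]) (auto simp: successively_append_iff)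
    qed
  qed
  then show ?thesis using that by blast
qed

section \<open>Depth and parents in a rooted tree\<close>

locale rooted_tree =
  fixes G :: "'a graph" and r :: 'a
  assumes tree: "tree G" and root: "r \<in> verts G"
begin

text \<open>The distance from \<open>r\<close>. It is meaningful only on \<open>verts G\<close>,
  where connectedness makes some \<open>n\<close> qualify.\<close>

definition depth :: "'a \<Rightarrow> nat" where
  "depth v = (LEAST n. (adj G ^^ n) r v)"

lemma adj_verts:
  assumes "adj G u v"
  shows "u \<in> verts G" "v \<in> verts G" "u \<noteq> v"
  using assms tree by (auto simp: tree_def simple_graph_def)

lemma relpowp_depth:
  assumes "v \<in> verts G"
  shows "(adj G ^^ depth v) r v"
proof -
  have "(adj G)\<^sup>*\<^sup>* r v"
    using assms tree root connected_graph_rtranclp by (metis tree_def)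
  then have "\<exists>n. (adj G ^^ n) r v"
    by (simp add: rtranclp_power)
  then show ?thesis
    unfolding depth_def by (rule LeastI_ex)
qed

text \<open>The parent is the vertex before \<open>v\<close> on a shortest walk from the
  root.\<close>

lemma parent_exists:
  assumes "v \<in> verts G" "v \<noteq> r"
  obtains u where "adj G u v" "depth u < depth v"
proof (cases "depth v")
  case 0
  then show ?thesis using relpowp_depth[OF assms(1)] assms(2) by simp
next
  case (Suc n)
  then obtain u where u: "(adj G ^^ n) r u" "adj G u v"
    using relpowp_depth[OF assms(1)] by auto
  have "depth u \<le> n"
    unfolding depth_def using u(1) by (rule Least_le)
  then show ?thesis using that u(2) Suc by simp
qed

text \<open>Passing to a parent strictly lowers the depth, so a climb that starts elsewhere and no
  deeper than \<open>v\<close> never meets \<open>v\<close>.\<close>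

lemma reach_root_avoiding:
  assumes "u \<in> verts G" "depth u \<le> depth v" "u \<noteq> v" "r \<noteq> v"
  shows "(\<lambda>x y. adj G x y \<and> x \<noteq> v \<and> y \<noteq> v)\<^sup>*\<^sup>* u r"
  using assms
proof (induction "depth u" arbitrary: u rule: less_induct)
  case less
  show ?case
  proof (cases "u = r")
    case False
    then obtain w where w: "adj G w u" "depth w < depth u"
      using parent_exists less.prems by blast
    then have "w \<noteq> v" using less.prems by auto
    then have "(\<lambda>x y. adj G x y \<and> x \<noteq> v \<and> y \<noteq> v)\<^sup>*\<^sup>* w r"
      using less.hyps[OF w(2)] w less.prems adj_verts by auto
    then show ?thesis
      using w \<open>w \<noteq> v\<close> less.prems
      by (intro converse_rtranclp_into_rtranclp[of _ u w]) (auto simp: insert_commute)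
  qed simp
qed

text \<open>If \<open>u\<close> and \<open>w\<close> differed, both could climb to the root around
  \<open>v\<close>, and a path between them avoiding \<open>v\<close> would close up to a cycle
  through \<open>v\<close>. The weak inequalities also cover neighbours of equal depth, as
  \<open>adj_depth_neq\<close> requires.\<close>

lemma parent_unique:
  assumes "adj G u v" "adj G w v" "depth u \<le> depth v" "depth w \<le> depth v"
  shows "u = w"
proof (rule ccontr)
  assume "u \<noteq> w"
  let ?R = "\<lambda>x y. adj G x y \<and> x \<noteq> v \<and> y \<noteq> v"
  have depth_r: "depth r = 0"
    unfolding depth_def by (rule Least_eq_0) simp
  have "r \<noteq> v"
  proof
    assume "r = v"
    then have "depth u = 0" using assms(3) depth_r by simp
    then have "u = r" using relpowp_depth[of u] adj_verts(1)[OF assms(1)] by simp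
    then show False using \<open>r = v\<close> adj_verts(3)[OF assms(1)] by simp
  qed
  then have "?R\<^sup>*\<^sup>* u r" "?R\<^sup>*\<^sup>* w r"
    using reach_root_avoiding assms adj_verts by meson+
  moreover have "symp ?R" by (auto simp: symp_def insert_commute)
  ultimately have "?R\<^sup>*\<^sup>* u w"
    by (meson rtranclp_trans symp_rtranclp sympD)
  then obtain p where p: "p \<noteq> []" "hd p = u" "last p = w" "distinct p" "successively ?R p"
    "\<forall>x\<in>set p. x = u \<or> (\<exists>y. ?R y x)"
    by (rule rtranclp_distinct_path)
  \<comment> \<open>Every vertex of \<open>p\<close> other than \<open>u\<close> is the target of an
    \<open>?R\<close> step, hence differs from \<open>v\<close>.\<close>
  have "v \<notin> set p" using p(6) adj_verts(3)[OF assms(1)] by auto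
  moreover have "successively (adj G) p"
    by (rule successively_mono[OF p(5)]) simp
  moreover have "set p \<subseteq> verts G"
    using p(6) adj_verts(1)[OF assms(1)] adj_verts(2) by auto
  \<comment> \<open>At least two vertices on \<open>p\<close>, together with \<open>v\<close>, make
    up the three that a cycle needs.\<close>
  moreover have "length p \<ge> 2"
    using p(1-3) \<open>u \<noteq> w\<close> by (cases p; cases "tl p") auto
  ultimately have "cycle G (v # p)"
    using p assms(1,2) adj_verts(2)[OF assms(1)]
    by (auto simp: cycle_def walk_def successively_Cons insert_commute)
  then show False using tree by (auto simp: tree_def)
qed

text \<open>Of two adjacent vertices of equal depth, one is not the root. Its parent and the other
  vertex would be two neighbours no deeper than it, against \<open>parent_unique\<close>.\<close>

lemma adj_depth_neq:
  assumes "adj G u v"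
  shows "depth u \<noteq> depth v"
proof
  assume eq: "depth u = depth v"
  have r: "v \<noteq> r \<or> u \<noteq> r" using adj_verts[OF assms] by auto
  have *: False if "adj G u v" "depth u = depth v" "v \<noteq> r" for u v
    using that parent_exists[of v] parent_unique[of u v] adj_verts[of u v]
    by (metis less_imp_le less_irrefl order_refl)
  show False using r *[of u v] *[of v u] assms eq by (auto simp: insert_commute)
qed

text \<open>Once a path goes down it never turns: a vertex after \<open>y\<close> and no deeper than
  \<open>y\<close> would equal \<open>x\<close> by \<open>parent_unique\<close>, against
  distinctness.\<close>

lemma depth_increasing:
  assumes "successively (adj G) (x # y # p)" "distinct (x # y # p)" "depth x < depth y"
  shows "depth x < depth (last (y # p))"
  using assms
proof (induction p arbitrary: x y)
  case (Cons z p)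
  have "\<not> depth z \<le> depth y"
    using parent_unique[of x y z] Cons.prems by (auto simp: insert_commute)
  then show ?case
    using Cons.IH[of y z] Cons.prems by auto
qed simp

section \<open>Topmost vertices and edges of subtrees\<close>

definition top_vertex :: "'a graph \<Rightarrow> 'a" where
  "top_vertex H = arg_min depth (\<lambda>v. v \<in> verts H)"

lemma top_vertex:
  assumes "tree H"
  shows "top_vertex H \<in> verts H" "v \<in> verts H \<Longrightarrow> depth (top_vertex H) \<le> depth v"
proof -
  obtain u where "u \<in> verts H"
    using assms by (auto simp: tree_def connected_graph_def)
  then show "top_vertex H \<in> verts H"
    unfolding top_vertex_def using arg_min_natI[of "\<lambda>v. v \<in> verts H"] by blast
  show "v \<in> verts H \<Longrightarrow> depth (top_vertex H) \<le> depth v"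
    unfolding top_vertex_def using arg_min_nat_le[of "\<lambda>v. v \<in> verts H"] by blast
qed

text \<open>The path inside \<open>H\<close> from \<open>v\<close> to the top vertex must start
  upwards: after a first step down it would end deeper than \<open>v\<close>, against minimality of
  the top vertex.\<close>

lemma subtree_parent:
  assumes H: "subtree H G" and v: "v \<in> verts H" "v \<noteq> top_vertex H"
  obtains u where "adj H u v" "depth u < depth v"
proof -
  let ?t = "top_vertex H"
  have "tree H" and sub: "edges H \<subseteq> edges G"
    using H by (auto simp: subtree_def subgraph_def)
  then have "(adj H)\<^sup>*\<^sup>* v ?t"
    using connected_graph_rtranclp top_vertex v by (metis tree_def)
  then obtain p where p: "p \<noteq> []" "hd p = v" "last p = ?t" "distinct p" "successively (adj H) p"
    by (rule rtranclp_distinct_path)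
  then obtain y q where q: "p = v # y # q"
    using v by (cases p; cases "tl p") auto
  then have vy: "adj H v y" using p by simp
  have "successively (adj G) p"
    by (rule successively_mono[OF p(5)]) (use sub in auto)
  then have "\<not> depth v < depth y"
    using depth_increasing[of v y q] p q top_vertex(2)[OF \<open>tree H\<close> v(1)] by auto
  moreover have "depth v \<noteq> depth y"
    using vy sub by (intro adj_depth_neq) auto
  ultimately show ?thesis
    using that[of y] vy by (simp add: insert_commute)
qed

text \<open>The parent of \<open>v\<close> inside \<open>H\<close> is shallower than
  \<open>v\<close> but no shallower than the top vertex. Hence \<open>arg_min\<close> had only one
  candidate.\<close>

lemma top_vertex_strict:
  assumes "subtree H G" "v \<in> verts H" "v \<noteq> top_vertex H"
  shows "depth (top_vertex H) < depth v"
proof -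
  obtain u where u: "adj H u v" "depth u < depth v"
    using subtree_parent[OF assms] .
  then have "u \<in> verts H"
    using assms(1) by (auto simp: subtree_def tree_def simple_graph_def)
  then show ?thesis
    using top_vertex(2)[of H u] assms(1) u(2) by (auto simp: subtree_def)
qed

text \<open>Away from the root, the edge from the top vertex to its parent lies outside
  \<open>H\<close> and meets \<open>H\<close> only in the top vertex, so leaf-cuttability makes that
  vertex a leaf. At the root, \<open>H\<close> inherits degree one from \<open>G\<close>.\<close>

lemma leaf_top_vertex:
  assumes r: "degree G r = 1" and H: "subtree H G" and cut: "leaf_cuttable H G"
  shows "leaf H (top_vertex H)"
proof -
  let ?t = "top_vertex H"
  have "tree H" using H by (simp add: subtree_def)
  note t = top_vertex[OF this]
  show ?thesis
  proof (cases "?t = r")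
    case True
    \<comment> \<open>An infinite set has \<open>card\<close> 0, so degree 1 forces
      finiteness.\<close>
    have fin: "finite {e \<in> edges G. r \<in> e}"
      using r by (metis card.infinite degree_def zero_neq_one)
    have sub: "edges H \<subseteq> edges G" using H by (auto simp: subtree_def subgraph_def)
    obtain e where e: "e \<in> edges H" using cut by (auto simp: leaf_cuttable_def)
    then obtain a b where "e = {a, b}" "a \<noteq> b" "a \<in> verts H" "b \<in> verts H"
      using \<open>tree H\<close> by (auto simp: tree_def simple_graph_def card_2_iff)
    then obtain c where c: "c \<in> verts H" "c \<noteq> ?t" by metis
    \<comment> \<open>The first edge on the way from the top vertex to \<open>c\<close> makes the
      degree in \<open>H\<close> positive.\<close>
    have "(adj H)\<^sup>*\<^sup>* ?t c"
      using connected_graph_rtranclp \<open>tree H\<close> t(1) c(1) by (metis tree_def)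
    then obtain d where "adj H ?t d" using c(2) by (blast elim: converse_rtranclpE)
    then have "{e \<in> edges H. r \<in> e} \<noteq> {}" using True by auto
    moreover have "{e \<in> edges H. r \<in> e} \<subseteq> {e \<in> edges G. r \<in> e}" using sub by auto
    ultimately have "degree H r = 1"
      using fin r card_mono[OF fin, of "{e \<in> edges H. r \<in> e}"] finite_subset[OF _ fin]
      by (simp add: degree_def le_antisym Suc_le_eq card_gt_0_iff)
    then show ?thesis using True t(1) by (simp add: leaf_def)
  next
    case False
    have "?t \<in> verts G" using t(1) H by (auto simp: subtree_def subgraph_def)
    then obtain u where u: "adj G u ?t" "depth u < depth ?t"
      using parent_exists False by blast
    have "u \<notin> verts H" using t(2) u(2) by force
    moreover from this have "\<not> adj H u ?t"
      using \<open>tree H\<close> by (auto simp: tree_def simple_graph_def)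
    ultimately obtain v where "leaf H v" "v \<in> {u, ?t}"
      using cut u(1) t(1) unfolding leaf_cuttable_def by (meson DiffI insertCI)
    then show ?thesis
      using \<open>u \<notin> verts H\<close> by (auto simp: leaf_def)
  qed
qed

text \<open>\<open>THE\<close> is certain to denote an edge once the top vertex is a leaf of
  \<open>H\<close>, whence the hypothesis of the lemma \<open>top_edge\<close>.\<close>

definition top_edge :: "'a graph \<Rightarrow> 'a set" where
  "top_edge H = (THE e. e \<in> edges H \<and> top_vertex H \<in> e)"

lemma top_edge:
  assumes "leaf H (top_vertex H)"
  shows "top_edge H \<in> edges H"
    "e \<in> edges H \<Longrightarrow> top_vertex H \<in> e \<Longrightarrow> e = top_edge H"
proof -
  have "card {e \<in> edges H. top_vertex H \<in> e} = 1"
    using assms by (simp add: leaf_def degree_def)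
  then obtain f where f: "{e \<in> edges H. top_vertex H \<in> e} = {f}"
    by (rule card_1_singletonE)
  then have iff: "e \<in> edges H \<and> top_vertex H \<in> e \<longleftrightarrow> e = f" for e
    by (simp add: set_eq_iff)
  then have "top_edge H = f"
    by (simp add: top_edge_def)
  with iff show "top_edge H \<in> edges H"
    "e \<in> edges H \<Longrightarrow> top_vertex H \<in> e \<Longrightarrow> e = top_edge H"
    by blast+
qed

text \<open>From a common edge, climb in \<open>X\<close> and \<open>Y\<close> simultaneously. Both
  use the unique parent in \<open>G\<close>, so the edges stay common, and \<open>Y\<close> cannot
  stop first because its top vertex is no deeper than that of \<open>X\<close>.\<close>

lemma top_edge_in_shallower:
  assumes X: "subtree X G" "leaf X (top_vertex X)" and Y: "subtree Y G"
    and meet: "edges X \<inter> edges Y \<noteq> {}"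
    and le: "depth (top_vertex Y) \<le> depth (top_vertex X)"
  shows "top_edge X \<in> edges Y"
proof -
  have sub: "edges X \<subseteq> edges G" "edges Y \<subseteq> edges G"
    and simple: "simple_graph X" "simple_graph Y"
    using X Y by (auto simp: subtree_def subgraph_def)
  have climb: "top_edge X \<in> edges Y" if "adj X a b" "adj Y a b" "depth a < depth b" for a b
    using that
  \<comment> \<open>The lower endpoint \<open>b\<close> measures progress: in the next common edge,
    \<open>a\<close> is the lower endpoint.\<close>
  proof (induction "depth b" arbitrary: a b rule: less_induct)
    case less
    show ?case
    proof (cases "a = top_vertex X")
      case True
      then show ?thesis using top_edge(2)[OF X(2)] less.prems by auto
    next
      case False
      have a: "a \<in> verts X" "a \<in> verts Y"
        using less.prems simple by (auto simp: simple_graph_def)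
      obtain c where c: "adj X c a" "depth c < depth a"
        using subtree_parent[OF X(1) a(1) False] .
      have "a \<noteq> top_vertex Y"
        using top_vertex_strict[OF X(1) a(1) False] le by auto
      then obtain c' where c': "adj Y c' a" "depth c' < depth a"
        using subtree_parent[OF Y a(2)] by blast
      have "c = c'"
        using parent_unique[of c a c'] c c' sub by auto
      then show ?thesis
        using less.hyps[of a c] less.prems c c' by auto
    qed
  qed
  obtain f where f: "f \<in> edges X" "f \<in> edges Y" using meet by auto
  then obtain a b where ab: "f = {a, b}"
    using simple by (auto simp: simple_graph_def card_2_iff)
  then have "depth a \<noteq> depth b" using f sub by (intro adj_depth_neq) auto
  then show ?thesis
    using climb[of a b] climb[of b a] f ab by (auto simp: insert_commute neq_iff)
qed

end

section \<open>Existence of a leaf and the greedy transversal\<close>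

text \<open>Root at any vertex and take a deepest \<open>v\<close>. All its neighbours are no
  deeper, so \<open>parent_unique\<close> leaves only one; an edge of \<open>G\<close> ensures that
  there is one.\<close>

lemma tree_leaf_exists:
  assumes "tree G" "edges G \<noteq> {}"
  obtains r where "r \<in> verts G" "degree G r = 1"
proof -
  have simple: "simple_graph G" using assms by (simp add: tree_def)
  obtain r0 where "r0 \<in> verts G"
    using assms(1) by (auto simp: tree_def connected_graph_def)
  then interpret rooted_tree G r0
    using assms(1) by unfold_locales
  have "finite (depth ` verts G)" "depth ` verts G \<noteq> {}"
    using simple \<open>r0 \<in> verts G\<close> by (auto simp: simple_graph_def)
  then have "Max (depth ` verts G) \<in> depth ` verts G" by (rule Max_in)
  then obtain v where v: "v \<in> verts G" "\<And>u. u \<in> verts G \<Longrightarrow> depth u \<le> depth v"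
    using Max_ge[OF \<open>finite (depth ` verts G)\<close>] by auto
  obtain e where "e \<in> edges G" using assms(2) by auto
  then obtain a b where "e = {a, b}" and ab: "a \<in> verts G" "b \<in> verts G" "a \<noteq> b"
    using simple by (auto simp: simple_graph_def card_2_iff)
  then obtain c where c: "c \<in> verts G" "c \<noteq> v" by metis
  have "(adj G)\<^sup>*\<^sup>* c v"
    using connected_graph_rtranclp assms(1) v(1) c(1) by (metis tree_def)
  then obtain u where u: "adj G u v" using c(2) by (blast elim: rtranclp.cases)
  have "e = {u, v}" if e: "e \<in> edges G" "v \<in> e" for e
  proof -
    obtain w where w: "e = {w, v}"
      using e simple by (fastforce simp: simple_graph_def card_2_iff)
    then show ?thesis
      using parent_unique[of w v u] u e(1) v(2) adj_verts(1) by blast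
  qed
  then have "{e \<in> edges G. v \<in> e} = {{u, v}}" using u by blast
  then have "degree G v = 1" by (simp add: degree_def)
  then show ?thesis using that v(1) by blast
qed

text \<open>The counting is separated from the tree structure, which enters only through the last
  hypothesis. Here \<open>k\<close> counts the selected edges, hence the Helly number
  \<open>Suc k\<close>.\<close>

lemma greedy_transversal:
  fixes rank :: "'a graph \<Rightarrow> nat"
  assumes "k_helly (Suc k) \<T>"
    and "\<And>X. X \<in> \<T> \<Longrightarrow> rank X \<le> B"
    and "\<And>X. X \<in> \<T> \<Longrightarrow> sel X \<in> edges X"
    and "\<And>X Y. X \<in> \<T> \<Longrightarrow> Y \<in> \<T> \<Longrightarrow> edges X \<inter> edges Y \<noteq> {} \<Longrightarrow> rank Y \<le> rank X
      \<Longrightarrow> sel X \<in> edges Y"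
  shows "\<exists>E \<subseteq> sel ` \<T>. finite E \<and> card E \<le> k \<and> (\<forall>X\<in>\<T>. edges X \<inter> E \<noteq> {})"
  using assms
proof (induction k arbitrary: \<T>)
  case 0
  have "\<T> = {}" using 0(1) k_helly_1[of \<T>] by simp
  then show ?case by auto
next
  case (Suc k)
  show ?case
  proof (cases "\<T> = {}")
    case True
    then show ?thesis by auto
  next
    case False
    then obtain X0 where "X0 \<in> \<T>" by blast
    \<comment> \<open>The bound on ranks, made strict by \<open>Suc B\<close>, yields a member of
      greatest rank.\<close>
    moreover have "\<forall>Y. Y \<in> \<T> \<longrightarrow> rank Y < Suc B"
      using Suc.prems(2) by (simp add: less_Suc_eq_le)
    ultimately obtain X where X: "X \<in> \<T>" "\<And>Y. Y \<in> \<T> \<Longrightarrow> rank Y \<le> rank X"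
      using ex_has_greatest_nat[of "\<lambda>X. X \<in> \<T>" X0 rank "Suc B"] by blast
    define \<T>' where "\<T>' = {Y \<in> \<T>. sel X \<notin> edges Y}"
    have disj: "edges X \<inter> edges Y = {}" if "Y \<in> \<T>'" for Y
      using that Suc.prems(4)[OF X(1)] X(2) by (auto simp: \<T>'_def)
    have "k_helly (Suc k) \<T>'"
      unfolding k_helly_def
    proof (intro allI impI)
      fix S :: "nat \<Rightarrow> 'a graph"
      assume S: "\<forall>i\<in>{1..Suc k}. S i \<in> \<T>'"
      \<comment> \<open>Append \<open>X\<close> as the last member. It shares no edge with any
        member of \<open>\<T>'\<close>, so the pair given by the Helly property lies among the first
        \<open>Suc k\<close> indices.\<close>
      let ?S = "S(Suc (Suc k) := X)"
      have "\<forall>i\<in>{1..Suc (Suc k)}. ?S i \<in> \<T>"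
        using S X(1) by (auto simp: \<T>'_def le_Suc_eq)
      then obtain i j where ij: "i \<in> {1..Suc (Suc k)}" "j \<in> {1..Suc (Suc k)}" "i \<noteq> j"
        "edges (?S i) \<inter> edges (?S j) \<noteq> {}"
        using Suc.prems(1) unfolding k_helly_def by blast
      have "i \<noteq> Suc (Suc k)"
      proof
        assume "i = Suc (Suc k)"
        then show False using ij S disj[of "S j"] by auto
      qed
      moreover have "j \<noteq> Suc (Suc k)"
      proof
        assume "j = Suc (Suc k)"
        then show False using ij S disj[of "S i"] by auto
      qed
      ultimately show "\<exists>i\<in>{1..Suc k}. \<exists>j\<in>{1..Suc k}. i \<noteq> j \<and> edges (S i) \<inter> edges (S j) \<noteq> {}"
        using ij by (intro bexI[of _ i] bexI[of _ j]) (auto simp: le_Suc_eq)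
    qed
    then have "\<exists>E \<subseteq> sel ` \<T>'. finite E \<and> card E \<le> k \<and> (\<forall>Y\<in>\<T>'. edges Y \<inter> E \<noteq> {})"
      by (rule Suc.IH) (auto simp: \<T>'_def intro: Suc.prems(2-4))
    then obtain E where E: "E \<subseteq> sel ` \<T>'" "finite E" "card E \<le> k" "\<forall>Y\<in>\<T>'. edges Y \<inter> E \<noteq> {}"
      by blast
    show ?thesis
    proof (intro exI[of _ "insert (sel X) E"] conjI ballI)
      show "card (insert (sel X) E) \<le> Suc k"
        using E(2,3) by (simp add: card_insert_if)
      show "edges Y \<inter> insert (sel X) E \<noteq> {}" if "Y \<in> \<T>" for Y
        using E(4) that by (cases "Y \<in> \<T>'") (auto simp: \<T>'_def)
    qed (use E(1,2) X(1) in \<open>auto simp: \<T>'_def\<close>)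
  qed
qed

theorem theorem5p10:
  fixes k :: nat and T :: "'a graph" and \<T> :: "'a graph set"
  assumes "k \<ge> 1"
    and "tree T"
    and "\<forall>T'\<in>\<T>. subtree T' T \<and> leaf_cuttable T' T"
    and "k_helly k \<T>"
  shows "\<exists>E. E \<subseteq> edges T \<and> finite E \<and> card E \<le> k - 1 \<and> (\<forall>T'\<in>\<T>. edges T' \<inter> E \<noteq> {})"
proof (cases "edges T = {}")
  case True
  \<comment> \<open>Without edges there is no leaf to root at, but members must have edges, so none
    exist.\<close>
  then have "\<T> = {}"
    using assms(3) by (fastforce simp: subtree_def subgraph_def leaf_cuttable_def)
  then show ?thesis by (intro exI[of _ "{}"]) simp
next
  case False
  then obtain r where r: "r \<in> verts T" "degree T r = 1"
    using tree_leaf_exists assms(2) by blast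
  then interpret rooted_tree T r
    using assms(2) by unfold_locales
  have subtree: "subtree X T" if "X \<in> \<T>" for X
    using assms(3) that by simp
  have leaf: "leaf X (top_vertex X)" if "X \<in> \<T>" for X
    using leaf_top_vertex[OF r(2) subtree[OF that]] assms(3) that by simp
  have bound: "depth (top_vertex X) \<le> Max (depth ` verts T)" if "X \<in> \<T>" for X
  proof (rule Max_ge)
    show "finite (depth ` verts T)"
      using assms(2) by (auto simp: tree_def simple_graph_def)
    show "depth (top_vertex X) \<in> depth ` verts T"
      using subtree[OF that] top_vertex(1)[of X] by (auto simp: subtree_def subgraph_def)
  qed
  \<comment> \<open>By \<open>k \<ge> 1\<close> the Helly number is a successor, and the greedy
    bound becomes \<open>k - 1\<close>.\<close>
  have "k_helly (Suc (k - 1)) \<T>" using assms(1,4) by simp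
  then have "\<exists>E \<subseteq> top_edge ` \<T>. finite E \<and> card E \<le> k - 1 \<and> (\<forall>X\<in>\<T>. edges X \<inter> E \<noteq> {})"
    using bound
  proof (rule greedy_transversal[where rank = "\<lambda>X. depth (top_vertex X)"])
    show "top_edge X \<in> edges X" if "X \<in> \<T>" for X
      using that by (intro top_edge(1) leaf)
    show "top_edge X \<in> edges Y"
      if "X \<in> \<T>" "Y \<in> \<T>" "edges X \<inter> edges Y \<noteq> {}"
        "depth (top_vertex Y) \<le> depth (top_vertex X)" for X Y
      using that by (intro top_edge_in_shallower subtree leaf)
  qed
  then obtain E where E: "E \<subseteq> top_edge ` \<T>" "finite E" "card E \<le> k - 1"
    "\<forall>X\<in>\<T>. edges X \<inter> E \<noteq> {}"
    by blast
  have "top_edge X \<in> edges T" if "X \<in> \<T>" for X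
    using top_edge(1)[OF leaf[OF that]] subtree[OF that]
    by (auto simp: subtree_def subgraph_def)
  then have "E \<subseteq> edges T" using E(1) by auto
  then show ?thesis using E(2-4) by blast
qed

end
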